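(* Let $\Sigma$ be the discrete-time linear time-invariant system $x(t+1)=Ax(t)+Bu(t)+Ed(t)$, $y(t)=Cx(t)+Du(t)+Fd(t)$, $t\in\mathbb{Z}_+$, with $x(t)\in\mathbb{R}^n$, $u(t)\in\mathbb{R}^m$, $y(t)\in\mathbb{R}^p$, $d(t)\in\mathbb{R}^r$, real matrices $A,B,C,D,E,F$, and $\begin{bmatrix} E \\ F \end{bmatrix}$ of full column rank $r$. Let $\{x_d(t)\}_{t=0}^{T-1},\{u_d(t)\}_{t=0}^{T-1},\{y_d(t)\}_{t=0}^{T-1}$ be data generated by $\Sigma$ on $[0,T-1]$ under the unknown input sequence $\{d_d(t)\}_{t=0}^{T-1}$, and form the data matrices $X_p,X_f,U_p,U_f,Y_p,Y_f,D_p,D_f$ and $\Phi_d$ defined in the context. Assume that the matrix $\begin{bmatrix} X_p^\top & U_p^\top & U_f^\top & D_p^\top & D_f^\top \end{bmatrix}^\top$ is of full row rank. Then there exists a UIO for $\Sigma$ of the form $z(t+1)=A_{UIO}z(t)+B^u_{UIO}u(t)+B^y_{UIO}y(t)$, $\hat x(t)=z(t)+D^u_{UIO}u(t)+D^y_{UIO}y(t)$ (with $z(t),\hat x(t)\in\mathbb{R}^n$) if and only if for every choice of real matrices $V_p,V_f,W_p,W_f,R_p,R_f$ of suitable sizes (all with the same number of rows, with $n,n,m,m,p,p$ columns, respectively) such that $$\ker\begin{bmatrix} V_p & V_f & W_p & W_f & R_p & R_f \end{bmatrix}=\mathrm{Im}(\Phi_d),$$ there exists a real matrix $\Omega$ such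 that $$\Omega\begin{bmatrix} V_p & V_f \end{bmatrix}=\begin{bmatrix} -A^* & I_n \end{bmatrix},$$ where $A^*\in\mathbb{R}^{n\times n}$ is a Schur matrix.
   Context: The data satisfy $x_d(t+1)=Ax_d(t)+Bu_d(t)+Ed_d(t)$ for $t\in\{0,\dots,T-2\}$ and $y_d(t)=Cx_d(t)+Du_d(t)+Fd_d(t)$ for $t\in\{0,\dots,T-1\}$. The data matrices, each with $T-1$ columns, are $X_p=[x_d(0)\ \cdots\ x_d(T-2)]$, $X_f=[x_d(1)\ \cdots\ x_d(T-1)]$, and analogously $U_p,U_f$ from $u_d$, $Y_p,Y_f$ from $y_d$, and $D_p,D_f$ from $d_d$ (subscript $p$: times $0,\dots,T-2$; subscript $f$: times $1,\dots,T-1$). Moreover $$\Phi_d=\begin{bmatrix} X_p^\top & X_f^\top & U_p^\top & U_f^\top & Y_p^\top & Y_f^\top \end{bmatrix}^\top\in\mathbb{R}^{2(n+m+p)\times(T-1)}.$$ All trajectories are defined on $\mathbb{Z}_+=\{0,1,2,\dots\}$. A system $\hat\Sigma$ of the form $z(t+1)=A_{UIO}z(t)+B^u_{UIO}u(t)+B^y_{UIO}y(t)$, $\hat x(t)=z(t)+D^u_{UIO}u(t)+D^y_{UIO}y(t)$ is an acceptor for $\Sigma$ if for every trajectory $(x,u,y,d)$ satisfying $\Sigma$ there exists $z$ such that $(\hat x=x,u,y,z)$ satisfies $\hat\Sigma$. $\hat\Sigma$ is an unknown-input observer (UIO) for $\Sigma$ if it is an acceptor and, when $\hat\Sigma$ is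 driven by the input $u$ and output $y$ of $\Sigma$, the error $e(t)=x(t)-\hat x(t)$ tends to $0$ as $t\to+\infty$ for every $x(0)$, $z(0)$, every input $u$ and every unknown input $d$. A real square matrix is Schur if all its eigenvalues have modulus less than $1$. $\ker$ and $\mathrm{Im}$ denote null space and column space. *)

theory Defs
  imports
    Complex_Main
    "Jordan_Normal_Form.Matrix_Kernel"
    "Jordan_Normal_Form.DL_Rank"
    "Jordan_Normal_Form.Char_Poly"
begin

definition append_cols :: "'a :: zero mat \<Rightarrow> 'a mat \<Rightarrow> 'a mat" (infixr \<open>@\<^sub>c\<close> 65) where
  "A @\<^sub>c B = four_block_mat A B (0\<^sub>m 0 (dim_col A)) (0\<^sub>m 0 (dim_col B))"

text \<open>The eigenvalues of a real matrix are its complex eigenvalues.\<close>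

definition schur_stable :: "real mat \<Rightarrow> bool" where
  "schur_stable A \<longleftrightarrow> square_mat A \<and>
    (\<forall>k. eigenvalue (map_mat complex_of_real A) k \<longrightarrow> cmod k < 1)"

definition euclid_norm :: "real vec \<Rightarrow> real" where
  "euclid_norm v = sqrt (v \<bullet> v)"

text \<open>
  A signal on the nonnegative integers is a function on \<^typ>\<open>nat\<close>; the dimensions of the signals
  of a system are read off from its matrices. Both kinds of system are represented by the set of
  their trajectories: \<open>(x, u, y, d)\<close> for the plant, \<open>(xh, u, y, z)\<close> for an observer, where \<open>xh\<close>
  is the state estimate and \<open>z\<close> the internal state.
\<close>

type_synonym signal = "nat \<Rightarrow> real vec"
type_synonym behavior = "(signal \<times> signal \<times> signal \<times> signal) set"

definition plant ::
  "real mat \<Rightarrow> real mat \<Rightarrow> real mat \<Rightarrow> real mat \<Rightarrow> real mat \<Rightarrow> real mat \<Rightarrow> behavior" where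
  "plant A B C D E F = {(x, u, y, d).
     (\<forall>t. x t \<in> carrier_vec (dim_row A) \<and> u t \<in> carrier_vec (dim_col B) \<and>
          y t \<in> carrier_vec (dim_row C) \<and> d t \<in> carrier_vec (dim_col E)) \<and>
     (\<forall>t. x (t + 1) = A *\<^sub>v x t + B *\<^sub>v u t + E *\<^sub>v d t) \<and>
     (\<forall>t. y t = C *\<^sub>v x t + D *\<^sub>v u t + F *\<^sub>v d t)}"

definition observer ::
  "real mat \<Rightarrow> real mat \<Rightarrow> real mat \<Rightarrow> real mat \<Rightarrow> real mat \<Rightarrow> behavior" where
  "observer A\<^sub>o Bu By Du Dy = {(xh, u, y, z).
     (\<forall>t. xh t \<in> carrier_vec (dim_row A\<^sub>o) \<and> u t \<in> carrier_vec (dim_col Bu) \<and>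
          y t \<in> carrier_vec (dim_col By) \<and> z t \<in> carrier_vec (dim_row A\<^sub>o)) \<and>
     (\<forall>t. z (t + 1) = A\<^sub>o *\<^sub>v z t + Bu *\<^sub>v u t + By *\<^sub>v y t) \<and>
     (\<forall>t. xh t = z t + Du *\<^sub>v u t + Dy *\<^sub>v y t)}"

definition acceptor :: "behavior \<Rightarrow> behavior \<Rightarrow> bool" where
  "acceptor Obs Sys \<longleftrightarrow> (\<forall>x u y d. (x, u, y, d) \<in> Sys \<longrightarrow> (\<exists>z. (x, u, y, z) \<in> Obs))"

text \<open>
  The initial states, the input and the unknown input can be chosen freely and determine the
  trajectories, so quantifying over all pairs of trajectories with the same \<open>u\<close> and \<open>y\<close> amounts
  to quantifying over \<open>x 0\<close>, \<open>z 0\<close>, \<open>u\<close> and \<open>d\<close>.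
\<close>

definition unknown_input_observer :: "behavior \<Rightarrow> behavior \<Rightarrow> bool" where
  "unknown_input_observer Obs Sys \<longleftrightarrow> acceptor Obs Sys \<and>
     (\<forall>x u y d xh z. (x, u, y, d) \<in> Sys \<longrightarrow> (xh, u, y, z) \<in> Obs \<longrightarrow>
        (\<lambda>t. euclid_norm (x t - xh t)) \<longlonglongrightarrow> 0)"

text \<open>Only the values of the data signals at times \<open>0, \<dots>, T - 1\<close> are constrained.\<close>

definition data_generated_by ::
  "real mat \<Rightarrow> real mat \<Rightarrow> real mat \<Rightarrow> real mat \<Rightarrow> real mat \<Rightarrow> real mat \<Rightarrow> nat \<Rightarrow>
   signal \<Rightarrow> signal \<Rightarrow> signal \<Rightarrow> signal \<Rightarrow> bool" where
  "data_generated_by A B C D E F T x u y d \<longleftrightarrow>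
     (\<forall>t<T. x t \<in> carrier_vec (dim_row A) \<and> u t \<in> carrier_vec (dim_col B) \<and>
            y t \<in> carrier_vec (dim_row C) \<and> d t \<in> carrier_vec (dim_col E)) \<and>
     (\<forall>t. t + 1 < T \<longrightarrow> x (t + 1) = A *\<^sub>v x t + B *\<^sub>v u t + E *\<^sub>v d t) \<and>
     (\<forall>t<T. y t = C *\<^sub>v x t + D *\<^sub>v u t + F *\<^sub>v d t)"

text \<open>Samples at times \<open>0, \<dots>, T - 2\<close> and \<open>1, \<dots>, T - 1\<close>, respectively, of a \<open>k\<close>-dimensional signal.\<close>

definition past :: "nat \<Rightarrow> nat \<Rightarrow> signal \<Rightarrow> real mat" where
  "past k T s = mat_of_cols k (map s [0..<T - 1])"

definition future :: "nat \<Rightarrow> nat \<Rightarrow> signal \<Rightarrow> real mat" where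
  "future k T s = mat_of_cols k (map s [1..<T])"

definition data_matrix ::
  "nat \<Rightarrow> nat \<Rightarrow> nat \<Rightarrow> nat \<Rightarrow> signal \<Rightarrow> signal \<Rightarrow> signal \<Rightarrow> real mat" where
  "data_matrix n m p T x u y =
     past n T x @\<^sub>r future n T x @\<^sub>r past m T u @\<^sub>r future m T u @\<^sub>r past p T y @\<^sub>r future p T y"

end

theory Submission
  imports Defs "Jordan_Normal_Form.Spectral_Radius"
begin

text \<open>
  By the rank assumption the columns of the data matrix span exactly the two-step windows
  \<open>(x(t), x(t+1), u(t), u(t+1), y(t), y(t+1))\<close> of the plant. An observer of the given form is an
  acceptor iff a certain block row matrix \<open>[-A\<^sub>o, I, \<dots>]\<close> annihilates all these windows, and an
  acceptor is an unknown-input observer iff \<open>A\<^sub>o\<close> is Schur, because the estimation error obeys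
  \<open>e(t+1) = A\<^sub>o e(t)\<close>. A matrix annihilates the kernel of \<open>V\<close> iff it has the form \<open>\<Omega> V\<close>; this, and
  the existence of a \<open>V\<close> whose kernel is a given column space, follow from the existence of
  generalized inverses \<open>V G V = V\<close>.
\<close>

section \<open>Generalized inverses, kernels and column spaces\<close>

lemma minus_eq_zero_vec_iff:
  fixes v w :: "'a :: ab_group_add vec"
  assumes "v \<in> carrier_vec n" "w \<in> carrier_vec n"
  shows "v - w = 0\<^sub>v n \<longleftrightarrow> v = w"
  using assms by (auto simp: vec_eq_iff)

lemma mult_mat_unit_vec:
  fixes A :: "'a :: semiring_1 mat"
  assumes "A \<in> carrier_mat nr nc" "j < nc"
  shows "A *\<^sub>v unit_vec nc j = col A j"
  using col_mult2[OF assms(1) one_carrier_mat assms(2)] assms by simp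

lemma outer_product_mult_vec:
  fixes e b v :: "'a :: comm_ring_1 vec"
  assumes "e \<in> carrier_vec m" "b \<in> carrier_vec n" "v \<in> carrier_vec n"
  shows "mat m n (\<lambda>(i, j). e $ i * b $ j) *\<^sub>v v = (b \<bullet> v) \<cdot>\<^sub>v e"
  using assms by (intro eq_vecI) (auto simp: scalar_prod_def sum_distrib_left mult_ac)

text \<open>Induction on the number \<open>k\<close> of columns of \<open>V\<close> that
  \<open>V * G\<close> already fixes. A further column either is fixed as well or leaves a nonzero
  residual, and then a rank-one update of \<open>G\<close> repairs it. Once all columns are fixed,
  \<open>V * G * V = V\<close> holds column by column.\<close>

lemma generalized_inverse_exists:
  fixes V :: "real mat"
  assumes V: "V \<in> carrier_mat q N"
  shows "\<exists>G \<in> carrier_mat N q. V * G * V = V"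
proof -
  have "\<exists>G \<in> carrier_mat N q. \<forall>j<k. V *\<^sub>v (G *\<^sub>v col V j) = col V j" if "k \<le> N" for k
    using that
  proof (induction k)
    case 0
    then show ?case by (intro bexI[of _ "0\<^sub>m N q"]) auto
  next
    case (Suc k)
    then obtain G where G: "G \<in> carrier_mat N q"
      and IH: "\<And>j. j < k \<Longrightarrow> V *\<^sub>v (G *\<^sub>v col V j) = col V j" by auto
    define a where "a = col V k"
    define c where "c = a - V *\<^sub>v (G *\<^sub>v a)"
    have a: "a \<in> carrier_vec q" using V Suc.prems by (auto simp: a_def)
    have VG: "V * G \<in> carrier_mat q q" using V G by auto
    have c: "c \<in> carrier_vec q" using a V G by (auto simp: c_def)
    show ?case
    proof (cases "c = 0\<^sub>v q")
      case True
      have "V *\<^sub>v (G *\<^sub>v a) = a"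
        using True minus_eq_zero_vec_iff[of a q "V *\<^sub>v (G *\<^sub>v a)"] a V G by (simp add: c_def)
      then show ?thesis using IH G by (intro bexI[of _ G]) (auto simp: less_Suc_eq a_def)
    next
      case False
      \<comment> \<open>Conjugation is trivial on the reals, so the scalar product is definite and
        division by \<open>c \<bullet> c\<close> is legitimate below.\<close>
      have cc: "c \<bullet> c \<noteq> 0"
        using False conjugate_square_eq_0_vec[OF c] by simp
      \<comment> \<open>\<open>b\<close> vanishes on the columns already handled and is \<open>1\<close> on \<open>a\<close>, so adding a rank-one
        multiple of it to \<open>G\<close> repairs column \<open>k\<close> without disturbing the others.\<close>
      define b where "b = (1 / (c \<bullet> c)) \<cdot>\<^sub>v ((1\<^sub>m q - V * G)\<^sup>T *\<^sub>v c)"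
      have b: "b \<in> carrier_vec q" using VG c
        by (auto simp: b_def intro!: mult_mat_vec_carrier[of _ q q] minus_carrier_mat)
      have bv: "b \<bullet> v = c \<bullet> (v - V *\<^sub>v (G *\<^sub>v v)) / (c \<bullet> c)" if v: "v \<in> carrier_vec q" for v
      proof -
        have "b \<bullet> v = ((1\<^sub>m q - V * G)\<^sup>T *\<^sub>v c) \<bullet> v / (c \<bullet> c)"
          using V G c v by (simp add: b_def)
        also have "((1\<^sub>m q - V * G)\<^sup>T *\<^sub>v c) \<bullet> v = c \<bullet> ((1\<^sub>m q - V * G) *\<^sub>v v)"
          using VG c v by (intro transpose_vec_mult_scalar[of _ q q]) (auto intro: minus_carrier_mat)
        finally show ?thesis
          using VG v V G by (simp add: minus_mult_distrib_mat_vec[of _ q q])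
      qed
      \<comment> \<open>Since \<open>V\<close> maps the unit vector to column \<open>k\<close>, it
        maps \<open>e\<close> to the residual \<open>c\<close>. Adding the outer product of
        \<open>e\<close> and \<open>b\<close> to \<open>G\<close> therefore shifts the image of each
        \<open>v\<close> by a multiple of \<open>c\<close>, which is exactly what \<open>a\<close>
        lacks.\<close>
      define e where "e = unit_vec N k - G *\<^sub>v a"
      have Ga: "G *\<^sub>v a \<in> carrier_vec N" using G a by auto
      have e: "e \<in> carrier_vec N" using G a by (auto simp: e_def)
      have Ve: "V *\<^sub>v e = c"
        using V Suc.prems Ga
        by (simp add: e_def c_def mult_minus_distrib_mat_vec[OF V] mult_mat_unit_vec[OF V] a_def)
      define H where "H = G + mat N q (\<lambda>(i, j). e $ i * b $ j)"
      have H: "H \<in> carrier_mat N q" using G by (auto simp: H_def)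
      have Hv: "V *\<^sub>v (H *\<^sub>v v) = V *\<^sub>v (G *\<^sub>v v) + (b \<bullet> v) \<cdot>\<^sub>v c" if v: "v \<in> carrier_vec q" for v
        using V G v e b Ve
        by (simp add: H_def add_mult_distrib_mat_vec[of _ N q] outer_product_mult_vec
            mult_add_distrib_mat_vec[of _ q N] mult_mat_vec[of _ q N])
      have "V *\<^sub>v (H *\<^sub>v col V j) = col V j" if j: "j < Suc k" for j
      proof (cases "j = k")
        case True
        have "b \<bullet> a = 1" using bv[OF a] cc by (simp add: c_def[symmetric])
        then show ?thesis
          using Hv[OF a] a c V unfolding True a_def[symmetric] by (auto simp: vec_eq_iff c_def)
      next
        case False
        hence jk: "j < k" using j by simp
        have v: "col V j \<in> carrier_vec q" using V by auto
        have "b \<bullet> col V j = 0" using bv[OF v] c v by (simp add: IH[OF jk])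
        then show ?thesis using Hv[OF v] v c by (auto simp: IH[OF jk] vec_eq_iff)
      qed
      then show ?thesis using H by blast
    qed
  qed
  from this[of N] obtain G where G: "G \<in> carrier_mat N q"
    and *: "\<And>j. j < N \<Longrightarrow> V *\<^sub>v (G *\<^sub>v col V j) = col V j" by auto
  have "V * G * V = V"
  proof (rule mat_col_eqI)
    fix j assume "j < dim_col V"
    then show "col (V * G * V) j = col V j"
      using V G * by (subst col_mult2[of _ q q _ N]) (auto simp: assoc_mult_mat_vec[of _ q N _ q])
  qed (use V G in auto)
  then show ?thesis using G by blast
qed

text \<open>If \<open>V * G * V = V\<close>, then each unit vector differs from its image under
  \<open>G * V\<close> by an element of the kernel of \<open>V\<close>. As \<open>M\<close> vanishes
  there, \<open>M = M * G * V\<close>, so \<open>M * G\<close> is the required left factor.\<close>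

lemma mat_kernel_factor:
  fixes V M :: "real mat"
  assumes V: "V \<in> carrier_mat q N" and M: "M \<in> carrier_mat k N"
    and sub: "mat_kernel V \<subseteq> mat_kernel M"
  shows "\<exists>\<Omega> \<in> carrier_mat k q. \<Omega> * V = M"
proof -
  obtain G where G: "G \<in> carrier_mat N q" and VGV: "V * G * V = V"
    using generalized_inverse_exists[OF V] by blast
  have "M * G * V = M"
  proof (rule mat_col_eqI)
    fix j assume j: "j < dim_col M"
    hence jN: "j < N" using M by simp
    define w where "w = unit_vec N j - G *\<^sub>v col V j"
    have w: "w \<in> carrier_vec N" using G V jN by (auto simp: w_def)
    have cV: "col V j \<in> carrier_vec q" using V by auto
    have Gc: "G *\<^sub>v col V j \<in> carrier_vec N" using G cV by auto
    have "V *\<^sub>v (G *\<^sub>v col V j) = col V j"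
    proof -
      have "V *\<^sub>v (G *\<^sub>v col V j) = (V * G) *\<^sub>v col V j"
        using V G cV by simp
      also have "\<dots> = col (V * G * V) j"
        using V G jN by (intro col_mult2[symmetric]) auto
      finally show ?thesis by (simp add: VGV)
    qed
    hence "V *\<^sub>v w = 0\<^sub>v q"
      using V G Gc cV jN by (simp add: w_def mult_minus_distrib_mat_vec[OF V] mult_mat_unit_vec[OF V])
    hence "w \<in> mat_kernel M" using sub V w by (auto simp: mat_kernel_def)
    hence "M *\<^sub>v w = 0\<^sub>v k" using M by (auto simp: mat_kernel_def)
    hence 0: "col M j - M *\<^sub>v (G *\<^sub>v col V j) = 0\<^sub>v k"
      using M Gc jN by (simp add: w_def mult_minus_distrib_mat_vec[OF M] mult_mat_unit_vec[OF M])
    have 1: "col (M * G * V) j = M *\<^sub>v (G *\<^sub>v col V j)"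
      using M G V jN cV by (subst col_mult2[of _ k q _ N]) (auto simp: assoc_mult_mat_vec[of _ k N _ q])
    show "col (M * G * V) j = col M j"
      unfolding 1 using minus_eq_zero_vec_iff[of "col M j" k "M *\<^sub>v (G *\<^sub>v col V j)"] 0 M Gc jN
      by (auto simp: carrier_vecI)
  qed (use V G M in auto)
  then show ?thesis using G M by (intro bexI[of _ "M * G"]) auto
qed

text \<open>The kernel of \<open>1 - \<Phi> * G\<close> consists of the fixed vectors of
  \<open>\<Phi> * G\<close>, and by \<open>\<Phi> * G * \<Phi> = \<Phi>\<close> these are the
  vectors in the range of \<open>\<Phi>\<close>. This provides an instance to which the universally
  quantified condition of the theorem can be applied.\<close>

lemma col_space_is_mat_kernel:
  fixes \<Phi> :: "real mat"
  assumes \<Phi>: "\<Phi> \<in> carrier_mat N c"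
  shows "\<exists>V \<in> carrier_mat N N. mat_kernel V = vec_space.col_space N \<Phi>"
proof -
  obtain G where G: "G \<in> carrier_mat c N" and g: "\<Phi> * G * \<Phi> = \<Phi>"
    using generalized_inverse_exists[OF \<Phi>] by blast
  define V where "V = 1\<^sub>m N - \<Phi> * G"
  have V: "V \<in> carrier_mat N N" using \<Phi> G by (auto simp: V_def)
  have Vv: "V *\<^sub>v v = v - \<Phi> *\<^sub>v (G *\<^sub>v v)" if "v \<in> carrier_vec N" for v
    using that \<Phi> G by (simp add: V_def minus_mult_distrib_mat_vec[of _ N N])
  have "mat_kernel V = {y \<in> carrier_vec N. \<exists>x \<in> carrier_vec c. \<Phi> *\<^sub>v x = y}"
  proof (intro equalityI subsetI)
    fix v assume "v \<in> mat_kernel V"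
    hence v: "v \<in> carrier_vec N" and "V *\<^sub>v v = 0\<^sub>v N" using V by (auto simp: mat_kernel_def)
    hence 0: "v - \<Phi> *\<^sub>v (G *\<^sub>v v) = 0\<^sub>v N" using Vv by simp
    have "\<Phi> *\<^sub>v (G *\<^sub>v v) = v"
      using minus_eq_zero_vec_iff[of v N "\<Phi> *\<^sub>v (G *\<^sub>v v)"] 0 v \<Phi> G by simp
    thus "v \<in> {y \<in> carrier_vec N. \<exists>x \<in> carrier_vec c. \<Phi> *\<^sub>v x = y}"
      using v G by (auto intro!: bexI[of _ "G *\<^sub>v v"])
  next
    fix v assume "v \<in> {y \<in> carrier_vec N. \<exists>x \<in> carrier_vec c. \<Phi> *\<^sub>v x = y}"
    then obtain x where x: "x \<in> carrier_vec c" and v: "v = \<Phi> *\<^sub>v x" by blast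
    have "\<Phi> *\<^sub>v (G *\<^sub>v v) = (\<Phi> * G * \<Phi>) *\<^sub>v x"
      using \<Phi> G x assoc_mult_mat_vec[of "\<Phi> * G" N N \<Phi> c x] unfolding v
      by (simp del: assoc_mult_mat)
    hence "\<Phi> *\<^sub>v (G *\<^sub>v v) = v" by (simp add: g v)
    hence "V *\<^sub>v v = 0\<^sub>v N" using Vv[of v] v \<Phi> x by simp
    thus "v \<in> mat_kernel V" using V v \<Phi> x by (auto simp: mat_kernel_def)
  qed
  then show ?thesis using V \<Phi> vec_space.col_space_eq[OF \<Phi>] by auto
qed

text \<open>A maximal independent set of columns has \<open>n\<close> elements, hence is a basis of
  the whole space. For the data this means that states, inputs and unknown inputs over two steps can
  be prescribed at will.\<close>

lemma (in vec_space) full_row_rank_col_space: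
  assumes A: "A \<in> carrier_mat n nc" and r: "rank A = n"
  shows "col_space A = carrier_vec n"
proof -
  have sub: "set (cols A) \<subseteq> carrier_vec n" using A cols_dim by blast
  obtain S where S: "finite S" "maximal S (\<lambda>T. T \<subseteq> set (cols A) \<and> lin_indpt T)"
    using maximal_exists_superset[of "set (cols A)" "\<lambda>T. T \<subseteq> set (cols A) \<and> lin_indpt T" "{}"]
      finite_lin_indpt2 by auto
  have SA: "S \<subseteq> set (cols A)" "lin_indpt S" using S(2) by (auto simp: maximal_def)
  have "card S = n" using rank_card_indpt[OF A S(2)] r by simp
  hence "basis S" using SA sub S(1) by (intro dim_li_is_basis) (auto simp: dim_is_n)
  hence "carrier_vec n = span S" by (auto simp: basis_def)
  also have "\<dots> \<subseteq> span (set (cols A))" using SA(1) by (rule span_is_monotone)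
  finally show ?thesis using span_closed[OF sub] by (auto simp: col_space_def)
qed

section \<open>Schur stability and convergence\<close>

abbreviation cmat :: "real mat \<Rightarrow> complex mat" where
  "cmat \<equiv> map_mat complex_of_real"

lemma smult_mat_mult_vec:
  fixes A :: "'a :: comm_ring_1 mat"
  assumes "A \<in> carrier_mat nr nc" "v \<in> carrier_vec nc"
  shows "(c \<cdot>\<^sub>m A) *\<^sub>v v = c \<cdot>\<^sub>v (A *\<^sub>v v)"
  using assms by (intro eq_vecI) auto

lemma pow_mat_Suc_left:
  fixes A :: "'a :: semiring_1 mat"
  assumes A: "A \<in> carrier_mat n n"
  shows "A ^\<^sub>m Suc k = A * A ^\<^sub>m k"
proof (induction k)
  case (Suc k)
  have "A ^\<^sub>m Suc (Suc k) = A ^\<^sub>m Suc k * A" by simp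
  also have "\<dots> = A * A ^\<^sub>m k * A" by (simp only: Suc.IH)
  also have "\<dots> = A * (A ^\<^sub>m k * A)" using A by (intro assoc_mult_mat) auto
  finally show ?case by simp
qed (use A in auto)

lemma norm_bound_mult_vec:
  fixes A :: "complex mat"
  assumes A: "A \<in> carrier_mat nr nc" and v: "v \<in> carrier_vec nc"
    and b: "norm_bound A b" and i: "i < nr"
  shows "cmod ((A *\<^sub>v v) $ i) \<le> (\<Sum>j<nc. b * cmod (v $ j))"
proof -
  have "(A *\<^sub>v v) $ i = (\<Sum>j<nc. A $$ (i, j) * v $ j)"
    using A v i by (auto simp: scalar_prod_def lessThan_atLeast0)
  also have "cmod \<dots> \<le> (\<Sum>j<nc. b * cmod (v $ j))"
    using b A i by (intro sum_norm_le) (auto simp: norm_mult norm_bound_def intro!: mult_right_mono)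
  finally show ?thesis .
qed

text \<open>With \<open>\<rho>\<close> strictly between the spectral radius and 1, the powers of
  \<open>A / \<rho>\<close> stay bounded, so the trajectory is dominated by a constant times
  \<open>\<rho> ^ t\<close>. The argument runs over the complex numbers, where the spectrum
  lives.\<close>

lemma schur_stable_imp_tendsto_0:
  assumes A: "A \<in> carrier_mat n n" and schur: "schur_stable A"
    and e: "\<And>t. e t \<in> carrier_vec n" and step: "\<And>t. e (t + 1) = A *\<^sub>v e t"
    and i: "i < n"
  shows "(\<lambda>t. e t $ i) \<longlonglongrightarrow> 0"
proof -
  have Ac: "cmat A \<in> carrier_mat n n" using A by simp
  \<comment> \<open>The index \<open>i\<close> excludes dimension 0, in which the spectrum is empty
    and has no element of maximal modulus.\<close>
  have n: "0 < n" using i by simp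
  have "spectral_radius (cmat A) < 1"
    using spectral_radius_mem_max(1)[OF Ac n] schur by (auto simp: schur_stable_def spectrum_def)
  then obtain \<rho> where \<rho>: "spectral_radius (cmat A) < \<rho>" "\<rho> < 1" using dense by blast
  have "0 \<le> spectral_radius (cmat A)" using spectral_radius_mem_max(1)[OF Ac n] by auto
  hence \<rho>0: "0 < \<rho>" using \<rho>(1) by simp
  \<comment> \<open>Rescaling by \<open>\<rho>\<close> turns boundedness of the powers into geometric decay.\<close>
  define S where "S = complex_of_real (1 / \<rho>) \<cdot>\<^sub>m cmat A"
  have S: "S \<in> carrier_mat n n" using A by (simp add: S_def)
  have AS: "cmat A = complex_of_real \<rho> \<cdot>\<^sub>m S"
    using \<rho>0 A by (intro eq_matI) (auto simp: S_def)
  \<comment> \<open>An eigenvalue \<open>k\<close> of \<open>S\<close> of maximal modulus yields the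
    eigenvalue \<open>\<rho> * k\<close> of \<open>A\<close>, whose modulus is at most the spectral
    radius of \<open>A\<close> and thus below \<open>\<rho>\<close>.\<close>
  have "spectral_radius S < 1"
  proof -
    obtain k where k: "eigenvalue S k" "spectral_radius S = cmod k"
      using spectral_radius_mem_max(1)[OF S n] by (auto simp: spectrum_def)
    then obtain v where v: "v \<in> carrier_vec n" "v \<noteq> 0\<^sub>v n" "S *\<^sub>v v = k \<cdot>\<^sub>v v"
      using S by (auto simp: eigenvalue_def eigenvector_def)
    have "cmat A *\<^sub>v v = (of_real \<rho> * k) \<cdot>\<^sub>v v"
      using smult_mat_mult_vec[OF S v(1), of "of_real \<rho>"] v by (simp add: AS smult_smult_assoc)
    hence "eigenvalue (cmat A) (of_real \<rho> * k)"
      using v A by (auto simp: eigenvalue_def eigenvector_def)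
    hence "cmod (of_real \<rho> * k) \<le> spectral_radius (cmat A)"
      by (intro spectral_radius_mem_max(2)[OF Ac n]) (auto simp: spectrum_def)
    hence "\<rho> * cmod k \<le> spectral_radius (cmat A)" using \<rho>0 by (simp add: norm_mult)
    hence "\<rho> * cmod k < \<rho>" using \<rho>(1) by linarith
    thus ?thesis using \<rho>0 k(2) by simp
  qed
  then obtain c where c: "\<And>k. norm_bound (S ^\<^sub>m k) c"
    using spectral_radius_jnf_norm_bound_less_1_upper_triangular[OF S] by blast
  define w where "w t = map_vec complex_of_real (e t)" for t
  have w: "w t \<in> carrier_vec n" for t using e by (simp add: w_def)
  have wS: "w (t + 1) = complex_of_real \<rho> \<cdot>\<^sub>v (S *\<^sub>v w t)" for t
  proof -
    have "w (t + 1) = cmat A *\<^sub>v w t"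
      unfolding w_def step by (rule of_real_hom.mult_mat_vec_hom[OF A e])
    then show ?thesis using smult_mat_mult_vec[OF S w] by (simp add: AS)
  qed
  have pow: "w t = of_real (\<rho> ^ t) \<cdot>\<^sub>v (S ^\<^sub>m t *\<^sub>v w 0)" for t
  proof (induction t)
    case 0
    then show ?case using w S by (simp add: one_smult_vec)
  next
    case (Suc t)
    have St: "S ^\<^sub>m t \<in> carrier_mat n n" using S by simp
    have "S ^\<^sub>m Suc t *\<^sub>v w 0 = S *\<^sub>v (S ^\<^sub>m t *\<^sub>v w 0)"
      using assoc_mult_mat_vec[OF S St w[of 0]] by (simp only: pow_mat_Suc_left[OF S])
    moreover have "w (Suc t) = of_real \<rho> \<cdot>\<^sub>v (S *\<^sub>v (of_real (\<rho> ^ t) \<cdot>\<^sub>v (S ^\<^sub>m t *\<^sub>v w 0)))"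
      using wS[of t] Suc.IH by simp
    ultimately show ?case
      using mult_mat_vec[OF S mult_mat_vec_carrier[OF St w[of 0]]]
      by (simp add: smult_smult_assoc)
  qed
  define K where "K = (\<Sum>j<n. c * cmod (w 0 $ j))"
  have bound: "\<bar>e t $ i\<bar> \<le> \<bar>\<rho> ^ t * K\<bar>" for t
  proof -
    have "\<bar>e t $ i\<bar> = cmod (w t $ i)" using e[of t] i by (simp add: w_def)
    also have "\<dots> = \<rho> ^ t * cmod ((S ^\<^sub>m t *\<^sub>v w 0) $ i)"
      using S i \<rho>0 unfolding pow[of t] by (simp add: norm_mult norm_power del: index_mult_mat_vec)
    also have "\<dots> \<le> \<rho> ^ t * K"
      using norm_bound_mult_vec[OF pow_carrier_mat[OF S] w[of 0] c[of t] i] \<rho>0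
      unfolding K_def by (intro mult_left_mono) auto
    also have "\<dots> \<le> \<bar>\<rho> ^ t * K\<bar>" by (rule abs_ge_self)
    finally show ?thesis .
  qed
  have "(\<lambda>t. \<rho> ^ t * K) \<longlonglongrightarrow> 0"
    using tendsto_mult_left_zero[OF LIMSEQ_power_zero[of \<rho>]] \<rho> \<rho>0 by simp
  then show ?thesis by (rule tendsto_0_le[where K = 1]) (simp add: bound del: abs_mult)
qed

text \<open>For a complex eigenvector \<open>v\<close> with eigenvalue \<open>k\<close>, the
  sequence \<open>k ^ t * v\<close> solves the recursion. The hypothesis covers real trajectories
  only, so it is applied separately to the real and the imaginary parts, which are trajectories
  because \<open>A\<close> is real.\<close>

lemma tendsto_0_imp_schur_stable:
  assumes A: "A \<in> carrier_mat n n"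
    and conv: "\<And>z i. (\<And>t. z t \<in> carrier_vec n) \<Longrightarrow> (\<And>t. z (t + 1) = A *\<^sub>v z t) \<Longrightarrow> i < n
      \<Longrightarrow> (\<lambda>t. z t $ i) \<longlonglongrightarrow> 0"
  shows "schur_stable A"
proof -
  have "cmod k < 1" if k: "eigenvalue (cmat A) k" for k
  proof -
    obtain v where v: "v \<in> carrier_vec n" "v \<noteq> 0\<^sub>v n" "cmat A *\<^sub>v v = k \<cdot>\<^sub>v v"
      using k A by (auto simp: eigenvalue_def eigenvector_def)
    then obtain i where i: "i < n" "v $ i \<noteq> 0" by (auto simp: vec_eq_iff)
    have step: "cmat A *\<^sub>v (k ^ t \<cdot>\<^sub>v v) = k ^ (t + 1) \<cdot>\<^sub>v v" for t
      using mult_mat_vec[of "cmat A" n n v "k ^ t"] A v by (simp add: smult_smult_assoc mult.commute)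
    have entry: "(\<Sum>j<n. complex_of_real (A $$ (l, j)) * (k ^ t * v $ j)) = k ^ (t + 1) * v $ l"
      if "l < n" for l t
    proof -
      have "(cmat A *\<^sub>v (k ^ t \<cdot>\<^sub>v v)) $ l = (\<Sum>j<n. complex_of_real (A $$ (l, j)) * (k ^ t * v $ j))"
        using A v that by (auto simp: scalar_prod_def lessThan_atLeast0)
      then show ?thesis using step[of t] that v(1) by simp
    qed
    have re: "(\<lambda>t. Re (k ^ t * v $ i)) \<longlonglongrightarrow> 0"
    proof -
      have "Re (k ^ (t + 1) * v $ l) = (\<Sum>j<n. A $$ (l, j) * Re (k ^ t * v $ j))" if "l < n" for l t
        unfolding entry[OF that, symmetric] by (simp add: algebra_simps)
      hence "vec n (\<lambda>j. Re (k ^ (t + 1) * v $ j)) = A *\<^sub>v vec n (\<lambda>j. Re (k ^ t * v $ j))" for t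
        using A by (intro eq_vecI) (simp_all add: scalar_prod_def lessThan_atLeast0)
      from conv[of "\<lambda>t. vec n (\<lambda>j. Re (k ^ t * v $ j))", OF _ this i(1)] show ?thesis using i by simp
    qed
    have im: "(\<lambda>t. Im (k ^ t * v $ i)) \<longlonglongrightarrow> 0"
    proof -
      have "Im (k ^ (t + 1) * v $ l) = (\<Sum>j<n. A $$ (l, j) * Im (k ^ t * v $ j))" if "l < n" for l t
        unfolding entry[OF that, symmetric] by (simp add: algebra_simps)
      hence "vec n (\<lambda>j. Im (k ^ (t + 1) * v $ j)) = A *\<^sub>v vec n (\<lambda>j. Im (k ^ t * v $ j))" for t
        using A by (intro eq_vecI) (simp_all add: scalar_prod_def lessThan_atLeast0)
      from conv[of "\<lambda>t. vec n (\<lambda>j. Im (k ^ t * v $ j))", OF _ this i(1)] show ?thesis using i by simp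
    qed
    have "(\<lambda>t. k ^ t * v $ i) \<longlonglongrightarrow> 0"
      using re im by (auto simp: tendsto_complex_iff)
    from tendsto_mult_right[OF this, of "inverse (v $ i)"] have "(\<lambda>t. k ^ t) \<longlonglongrightarrow> 0"
      using i(2) by (simp add: mult.assoc)
    \<comment> \<open>A single power of modulus below 1 suffices: if \<open>cmod k\<close> were at
      least 1, so would be all its powers.\<close>
    from LIMSEQ_D[OF this, of 1] obtain t where "cmod k ^ t < 1"
      by (auto simp: norm_power)
    then show ?thesis using one_le_power[of "cmod k" t] by linarith
  qed
  then show ?thesis using A by (auto simp: schur_stable_def)
qed

section \<open>Two-step windows and the data matrix\<close>

lemma append_cols_carrier [simp, intro]:
  "A \<in> carrier_mat q a \<Longrightarrow> B \<in> carrier_mat q b \<Longrightarrow> A @\<^sub>c B \<in> carrier_mat q (a + b)"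
  by (auto simp: append_cols_def)

lemma append_cols_dim [simp]:
  "dim_row (A @\<^sub>c B) = dim_row A" "dim_col (A @\<^sub>c B) = dim_col A + dim_col B"
  by (auto simp: append_cols_def)

lemma append_cols_mult_append_vec:
  fixes A B :: "'a :: comm_semiring_1 mat"
  assumes "dim_row A = dim_row B" "dim_vec v = dim_col A" "dim_vec w = dim_col B"
  shows "(A @\<^sub>c B) *\<^sub>v (v @\<^sub>v w) = A *\<^sub>v v + B *\<^sub>v w"
proof -
  \<comment> \<open>The lower blocks in the encoding of \<open>append_cols\<close> have no rows, so
    the second part of the resulting vector is empty.\<close>
  have "(A @\<^sub>c B) *\<^sub>v (v @\<^sub>v w)
    = (A *\<^sub>v v + B *\<^sub>v w) @\<^sub>v (0\<^sub>m 0 (dim_col A) *\<^sub>v v + 0\<^sub>m 0 (dim_col B) *\<^sub>v w)"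
    unfolding append_cols_def
    by (rule four_block_mat_mult_vec[of _ "dim_row A" _ _ _ _ 0])
      (use assms in \<open>auto intro: carrier_vecI\<close>)
  then show ?thesis using assms by (auto simp: vec_eq_iff)
qed

lemma mult_append_cols:
  fixes M A B :: "'a :: semiring_1 mat"
  assumes "M \<in> carrier_mat k q" "A \<in> carrier_mat q a" "B \<in> carrier_mat q b"
  shows "M * (A @\<^sub>c B) = (M * A) @\<^sub>c (M * B)"
proof (rule eq_matI)
  fix i j assume "i < dim_row ((M * A) @\<^sub>c (M * B))" "j < dim_col ((M * A) @\<^sub>c (M * B))"
  then show "(M * (A @\<^sub>c B)) $$ (i, j) = ((M * A) @\<^sub>c (M * B)) $$ (i, j)"
    using assms by (cases "j < a") (auto simp: append_cols_def scalar_prod_def)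
qed (use assms in auto)

lemma append_cols_eq_iff:
  assumes "A \<in> carrier_mat q a" "A' \<in> carrier_mat q a" "B \<in> carrier_mat q b" "B' \<in> carrier_mat q b"
  shows "A @\<^sub>c B = A' @\<^sub>c B' \<longleftrightarrow> A = A' \<and> B = B'"
proof
  assume eq: "A @\<^sub>c B = A' @\<^sub>c B'"
  have "A $$ (i, j) = A' $$ (i, j)" if "i < q" "j < a" for i j
    using arg_cong[OF eq, of "\<lambda>M. M $$ (i, j)"] that assms by (simp add: append_cols_def)
  moreover have "B $$ (i, j) = B' $$ (i, j)" if "i < q" "j < b" for i j
    using arg_cong[OF eq, of "\<lambda>M. M $$ (i, a + j)"] that assms by (simp add: append_cols_def)
  ultimately show "A = A' \<and> B = B'" using assms by (intro conjI eq_matI) auto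
qed simp

text \<open>Used to cut an arbitrary matrix into the blocks over which the theorem
  quantifies.\<close>

lemma append_cols_cases:
  assumes "V \<in> carrier_mat q (a + b)"
  obtains L R where "L \<in> carrier_mat q a" "R \<in> carrier_mat q b" "V = L @\<^sub>c R"
proof
  show "V = mat q a (\<lambda>(i, j). V $$ (i, j)) @\<^sub>c mat q b (\<lambda>(i, j). V $$ (i, a + j))"
    using assms by (intro eq_matI) (auto simp: append_cols_def)
qed auto

lemma append_rows_dim [simp]:
  "dim_row (A @\<^sub>r B) = dim_row A + dim_row B" "dim_col (A @\<^sub>r B) = dim_col A"
  by (auto simp: append_rows_def)

lemma append_rows_mult_vec:
  assumes "dim_col A = dim_col B" "dim_vec v = dim_col A"
  shows "(A @\<^sub>r B) *\<^sub>v v = (A *\<^sub>v v) @\<^sub>v (B *\<^sub>v v)"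
  by (rule mat_mult_append[of _ "dim_row A" "dim_col A" _ "dim_row B"])
      (use assms in \<open>auto intro: carrier_vecI\<close>)

lemma past_future_dim [simp]:
  "dim_row (past k T s) = k" "dim_col (past k T s) = T - 1"
  "dim_row (future k T s) = k" "dim_col (future k T s) = T - 1"
  by (auto simp: past_def future_def)

lemma past_future_carrier [simp]:
  "past k T s \<in> carrier_mat k (T - 1)" "future k T s \<in> carrier_mat k (T - 1)"
  by auto

lemma past_index: "i < k \<Longrightarrow> j < T - 1 \<Longrightarrow> past k T s $$ (i, j) = s j $ i"
  by (simp add: past_def mat_of_cols_index)

lemma future_index: "i < k \<Longrightarrow> j < T - 1 \<Longrightarrow> future k T s $$ (i, j) = s (j + 1) $ i"
  by (simp add: future_def mat_of_cols_index)

lemma past_col: "j < T - 1 \<Longrightarrow> s j \<in> carrier_vec k \<Longrightarrow> col (past k T s) j = s j"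
  by (simp add: past_def)

lemma future_col: "j < T - 1 \<Longrightarrow> s (j + 1) \<in> carrier_vec k \<Longrightarrow> col (future k T s) j = s (j + 1)"
  by (simp add: future_def)

lemma sum_mult_vec:
  fixes A B E :: "'a :: comm_semiring_1 mat"
  assumes "A \<in> carrier_mat k a" "B \<in> carrier_mat k b" "E \<in> carrier_mat k e"
    and "P \<in> carrier_mat a c" "Q \<in> carrier_mat b c" "R \<in> carrier_mat e c" "g \<in> carrier_vec c"
  shows "(A * P + B * Q + E * R) *\<^sub>v g = A *\<^sub>v (P *\<^sub>v g) + B *\<^sub>v (Q *\<^sub>v g) + E *\<^sub>v (R *\<^sub>v g)"
  using assms by (simp add: add_mult_distrib_mat_vec[of _ k c])

section \<open>Two-step windows of the plant and their generation by the data\<close>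

locale plant_matrices =
  fixes A B C D E F :: "real mat" and n m p r :: nat
  assumes A: "A \<in> carrier_mat n n" and B: "B \<in> carrier_mat n m" and C: "C \<in> carrier_mat p n"
    and D: "D \<in> carrier_mat p m" and E: "E \<in> carrier_mat n r" and F: "F \<in> carrier_mat p r"
begin

text \<open>The blocks are stacked in the order of the block rows of \<^const>\<open>data_matrix\<close>.\<close>

definition windows :: "real vec set" where
  "windows = {x0 @\<^sub>v x1 @\<^sub>v u0 @\<^sub>v u1 @\<^sub>v y0 @\<^sub>v y1 |x0 x1 u0 u1 y0 y1.
     \<exists>d0 \<in> carrier_vec r. \<exists>d1 \<in> carrier_vec r.
       x0 \<in> carrier_vec n \<and> u0 \<in> carrier_vec m \<and> u1 \<in> carrier_vec m \<and>
       x1 = A *\<^sub>v x0 + B *\<^sub>v u0 + E *\<^sub>v d0 \<and>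
       y0 = C *\<^sub>v x0 + D *\<^sub>v u0 + F *\<^sub>v d0 \<and>
       y1 = C *\<^sub>v x1 + D *\<^sub>v u1 + F *\<^sub>v d1}"

text \<open>The plant equations express the blocks of future states and of past and future outputs
  linearly by the remaining ones, so every combination of data columns is a window. Conversely, a
  window is determined by its initial state, two inputs and two unknown inputs, and by the rank
  assumption some combination \<open>g\<close> of the columns attains any such choice.\<close>

lemma col_space_data_matrix:
  assumes data: "data_generated_by A B C D E F T x u y d"
    and rank: "vec_space.rank (n + m + m + r + r)
           (past n T x @\<^sub>r past m T u @\<^sub>r future m T u @\<^sub>r past r T d @\<^sub>r future r T d)
         = n + m + m + r + r"
  shows "vec_space.col_space (2 * (n + m + p)) (data_matrix n m p T x u y) = windows"
proof -
  let ?M = "past n T x @\<^sub>r past m T u @\<^sub>r future m T u @\<^sub>r past r T d @\<^sub>r future r T d"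
  let ?c = "carrier_vec (T - 1) :: real vec set"
  have car: "x t \<in> carrier_vec n" "u t \<in> carrier_vec m" "y t \<in> carrier_vec p" "d t \<in> carrier_vec r"
    if "t < T" for t
    using data that A B C E by (auto simp: data_generated_by_def)
  \<comment> \<open>Column \<open>j\<close> of \<open>future\<close> is sample \<open>j + 1\<close>.
    The bound \<open>j < T - 1\<close> keeps both \<open>j\<close> and \<open>j + 1\<close> below
    \<open>T\<close>, where the data equations are available.\<close>
  have Xf: "future n T x = A * past n T x + B * past m T u + E * past r T d"
  proof (rule mat_col_eqI)
    fix j assume "j < dim_col (A * past n T x + B * past m T u + E * past r T d)"
    hence j: "j < T - 1" by simp
    have "x (j + 1) = A *\<^sub>v x j + B *\<^sub>v u j + E *\<^sub>v d j"
      using data j by (auto simp: data_generated_by_def)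
    thus "col (future n T x) j = col (A * past n T x + B * past m T u + E * past r T d) j"
      using j A B C D E F car by (auto simp: vec_eq_iff past_index future_index past_col future_col)
  qed (use A B C D E F in auto)
  have Yp: "past p T y = C * past n T x + D * past m T u + F * past r T d"
  proof (rule mat_col_eqI)
    fix j assume "j < dim_col (C * past n T x + D * past m T u + F * past r T d)"
    hence j: "j < T - 1" by simp
    have "y j = C *\<^sub>v x j + D *\<^sub>v u j + F *\<^sub>v d j"
      using data j by (auto simp: data_generated_by_def)
    thus "col (past p T y) j = col (C * past n T x + D * past m T u + F * past r T d) j"
      using j A B C D E F car by (auto simp: vec_eq_iff past_index future_index past_col future_col)
  qed (use A B C D E F in auto)
  have Yf: "future p T y = C * future n T x + D * future m T u + F * future r T d"
  proof (rule mat_col_eqI)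
    fix j assume "j < dim_col (C * future n T x + D * future m T u + F * future r T d)"
    hence j: "j < T - 1" by simp
    have "y (j + 1) = C *\<^sub>v x (j + 1) + D *\<^sub>v u (j + 1) + F *\<^sub>v d (j + 1)"
      using data j by (auto simp: data_generated_by_def)
    thus "col (future p T y) j = col (C * future n T x + D * future m T u + F * future r T d) j"
      using j A B C D E F car by (auto simp: vec_eq_iff past_index future_index past_col future_col)
  qed (use A B C D E F in auto)
  have Xfg: "future n T x *\<^sub>v g
      = A *\<^sub>v (past n T x *\<^sub>v g) + B *\<^sub>v (past m T u *\<^sub>v g) + E *\<^sub>v (past r T d *\<^sub>v g)"
    if g: "g \<in> ?c" for g
    unfolding Xf by (rule sum_mult_vec[OF A B E _ _ _ g]) auto
  have Ypg: "past p T y *\<^sub>v g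
      = C *\<^sub>v (past n T x *\<^sub>v g) + D *\<^sub>v (past m T u *\<^sub>v g) + F *\<^sub>v (past r T d *\<^sub>v g)"
    if g: "g \<in> ?c" for g
    unfolding Yp by (rule sum_mult_vec[OF C D F _ _ _ g]) auto
  have Yfg: "future p T y *\<^sub>v g
      = C *\<^sub>v (future n T x *\<^sub>v g) + D *\<^sub>v (future m T u *\<^sub>v g) + F *\<^sub>v (future r T d *\<^sub>v g)"
    if g: "g \<in> ?c" for g
    unfolding Yf by (rule sum_mult_vec[OF C D F _ _ _ g]) auto
  have \<Phi>g: "data_matrix n m p T x u y *\<^sub>v g = past n T x *\<^sub>v g @\<^sub>v future n T x *\<^sub>v g @\<^sub>v
      past m T u *\<^sub>v g @\<^sub>v future m T u *\<^sub>v g @\<^sub>v past p T y *\<^sub>v g @\<^sub>v future p T y *\<^sub>v g"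
    if "g \<in> ?c" for g
    using that by (simp add: data_matrix_def append_rows_mult_vec)
  have \<Phi>: "data_matrix n m p T x u y \<in> carrier_mat (2 * (n + m + p)) (T - 1)"
    by (auto simp: data_matrix_def intro: carrier_matI)
  have M: "?M \<in> carrier_mat (n + m + m + r + r) (T - 1)"
    by (auto intro: carrier_matI)
  have car': "past k T s *\<^sub>v g \<in> carrier_vec k" "future k T s *\<^sub>v g \<in> carrier_vec k" for k s g
    by (auto intro: carrier_vecI)
  have "vec_space.col_space (2 * (n + m + p)) (data_matrix n m p T x u y)
      = {data_matrix n m p T x u y *\<^sub>v g |g. g \<in> ?c}"
    using vec_space.col_space_eq[OF \<Phi>] \<Phi> by (auto intro: mult_mat_vec_carrier)
  also have "\<dots> = windows"
  proof (intro equalityI subsetI)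
    fix v assume "v \<in> {data_matrix n m p T x u y *\<^sub>v g |g. g \<in> ?c}"
    then obtain g where g: "g \<in> ?c" and v: "v = data_matrix n m p T x u y *\<^sub>v g" by blast
    show "v \<in> windows"
      unfolding windows_def mem_Collect_eq v \<Phi>g[OF g]
      using Xfg[OF g] Ypg[OF g] Yfg[OF g] car' by blast
  next
    fix v assume "v \<in> windows"
    then obtain x0 x1 u0 u1 y0 y1 d0 d1
      where v: "v = x0 @\<^sub>v x1 @\<^sub>v u0 @\<^sub>v u1 @\<^sub>v y0 @\<^sub>v y1"
        and c: "d0 \<in> carrier_vec r" "d1 \<in> carrier_vec r" "x0 \<in> carrier_vec n"
          "u0 \<in> carrier_vec m" "u1 \<in> carrier_vec m"
        and eqs: "x1 = A *\<^sub>v x0 + B *\<^sub>v u0 + E *\<^sub>v d0" "y0 = C *\<^sub>v x0 + D *\<^sub>v u0 + F *\<^sub>v d0"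
          "y1 = C *\<^sub>v x1 + D *\<^sub>v u1 + F *\<^sub>v d1"
      unfolding windows_def by blast
    \<comment> \<open>The free parameters of the window are realized by some \<open>g\<close>; the
      other blocks then agree automatically, because both sides obey the plant equations.\<close>
    have "x0 @\<^sub>v u0 @\<^sub>v u1 @\<^sub>v d0 @\<^sub>v d1 \<in> carrier_vec (n + m + m + r + r)"
      using c by (auto intro!: carrier_vecI)
    also have "\<dots> = vec_space.col_space (n + m + m + r + r) ?M"
      using vec_space.full_row_rank_col_space[OF M rank] by simp
    finally obtain g where g: "g \<in> ?c" and "?M *\<^sub>v g = x0 @\<^sub>v u0 @\<^sub>v u1 @\<^sub>v d0 @\<^sub>v d1"
      using vec_space.col_space_eq[OF M] M by auto
    hence "past n T x *\<^sub>v g @\<^sub>v past m T u *\<^sub>v g @\<^sub>v future m T u *\<^sub>v g @\<^sub>v past r T d *\<^sub>v g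
        @\<^sub>v future r T d *\<^sub>v g = x0 @\<^sub>v u0 @\<^sub>v u1 @\<^sub>v d0 @\<^sub>v d1"
      by (simp add: append_rows_mult_vec)
    hence "past n T x *\<^sub>v g = x0" "past m T u *\<^sub>v g = u0" "future m T u *\<^sub>v g = u1"
      "past r T d *\<^sub>v g = d0" "future r T d *\<^sub>v g = d1"
      using append_vec_eq[OF car'(1) c(3)] append_vec_eq[OF car'(1) c(4)]
        append_vec_eq[OF car'(2) c(5)] append_vec_eq[OF car'(1) c(1)] by auto
    hence "v = data_matrix n m p T x u y *\<^sub>v g"
      using Xfg[OF g] Ypg[OF g] Yfg[OF g] by (simp add: \<Phi>g[OF g] v eqs)
    then show "v \<in> {data_matrix n m p T x u y *\<^sub>v g |g. g \<in> ?c}" using g by blast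
  qed
  finally show ?thesis .
qed

text \<open>The state is defined by recursion and the output is read off from it. This is what
  allows a window to be continued to a trajectory on all nonnegative times.\<close>

lemma plant_trajectory_exists:
  assumes x0: "x0 \<in> carrier_vec n" and u: "\<And>t. u t \<in> carrier_vec m" and d: "\<And>t. d t \<in> carrier_vec r"
  obtains x y where "(x, u, y, d) \<in> plant A B C D E F" "x 0 = x0"
proof -
  define x where "x = rec_nat x0 (\<lambda>t v. A *\<^sub>v v + B *\<^sub>v u t + E *\<^sub>v d t)"
  define y where "y t = C *\<^sub>v x t + D *\<^sub>v u t + F *\<^sub>v d t" for t
  have x: "x t \<in> carrier_vec n" for t
  proof (induction t)
    case (Suc t)
    then show ?case
      using A B E u d
      by (auto simp: x_def intro!: add_carrier_vec mult_mat_vec_carrier)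
  qed (simp add: x_def x0)
  have "(x, u, y, d) \<in> plant A B C D E F"
    using A B C D E F x u d by (auto simp: plant_def y_def) (auto simp: x_def)
  moreover have "x 0 = x0" by (simp add: x_def)
  ultimately show ?thesis using that by blast
qed

end

section \<open>Observers\<close>

lemma abs_index_le_euclid_norm:
  assumes "i < dim_vec v"
  shows "\<bar>v $ i\<bar> \<le> euclid_norm v"
proof -
  have "(v $ i)\<^sup>2 \<le> (\<Sum>j<dim_vec v. (v $ j)\<^sup>2)"
    using assms by (intro member_le_sum) auto
  also have "\<dots> = v \<bullet> v" by (simp add: scalar_prod_def power2_eq_square lessThan_atLeast0)
  finally show ?thesis unfolding euclid_norm_def by (intro real_le_rsqrt) simp
qed

lemma tendsto_euclid_norm_0:
  assumes e: "\<And>t. e t \<in> carrier_vec n" and lim: "\<And>i. i < n \<Longrightarrow> (\<lambda>t. e t $ i) \<longlonglongrightarrow> 0"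
  shows "(\<lambda>t. euclid_norm (e t)) \<longlonglongrightarrow> 0"
proof -
  have "euclid_norm (e t) = sqrt (\<Sum>i<n. e t $ i * e t $ i)" for t
    using e[of t] by (auto simp: euclid_norm_def scalar_prod_def lessThan_atLeast0)
  moreover have "(\<lambda>t. sqrt (\<Sum>i<n. e t $ i * e t $ i)) \<longlonglongrightarrow> sqrt (\<Sum>i<n. 0 * 0)"
    using lim by (intro tendsto_intros) auto
  ultimately show ?thesis by simp
qed

context plant_matrices
begin

lemma zero_trajectory: "((\<lambda>_. 0\<^sub>v n), (\<lambda>_. 0\<^sub>v m), (\<lambda>_. 0\<^sub>v p), (\<lambda>_. 0\<^sub>v r)) \<in> plant A B C D E F"
  using A B C D E F by (auto simp: plant_def)

section \<open>Error dynamics and Schur stability of the observer matrix\<close>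

lemma unknown_input_observer_imp_schur_stable:
  assumes Ao: "Ao \<in> carrier_mat n n" and Bu: "Bu \<in> carrier_mat n m" and By: "By \<in> carrier_mat n p"
    and Du: "Du \<in> carrier_mat n m" and Dy: "Dy \<in> carrier_mat n p"
    and uio: "unknown_input_observer (observer Ao Bu By Du Dy) (plant A B C D E F)"
  shows "schur_stable Ao"
proof (rule tendsto_0_imp_schur_stable[OF Ao])
  \<comment> \<open>Along the zero trajectory of the plant the observer runs freely.\<close>
  fix z :: signal and i
  assume z: "\<And>t. z t \<in> carrier_vec n" and step: "\<And>t. z (t + 1) = Ao *\<^sub>v z t" and i: "i < n"
  \<comment> \<open>With zero input and output the estimate equals the internal state, so
    \<open>z\<close> fills both positions and the estimation error is \<open>- z t\<close>.\<close>
  have "(z, (\<lambda>_. 0\<^sub>v m), (\<lambda>_. 0\<^sub>v p), z) \<in> observer Ao Bu By Du Dy"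
    unfolding observer_def mem_Collect_eq prod.case step
    using z Ao Bu By Du Dy by (auto simp: mult_mat_vec_carrier[OF Ao])
  hence lim: "(\<lambda>t. euclid_norm (0\<^sub>v n - z t)) \<longlonglongrightarrow> 0"
    using uio zero_trajectory unfolding unknown_input_observer_def by blast
  have "\<bar>z t $ i\<bar> \<le> \<bar>euclid_norm (0\<^sub>v n - z t)\<bar>" for t
    using abs_index_le_euclid_norm[of i "0\<^sub>v n - z t"] z[of t] i by simp
  then show "(\<lambda>t. z t $ i) \<longlonglongrightarrow> 0"
    by (intro tendsto_0_le[where K = 1, OF lim]) simp
qed

text \<open>Acceptance supplies an internal trajectory \<open>w\<close> whose estimate is exactly
  \<open>x\<close>. Any other internal trajectory \<open>z\<close> for the same input and output
  differs from it by a solution of the homogeneous recursion, and this difference is the estimation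
  error.\<close>

lemma acceptor_schur_stable_imp_unknown_input_observer:
  assumes Ao: "Ao \<in> carrier_mat n n" and Bu: "Bu \<in> carrier_mat n m" and By: "By \<in> carrier_mat n p"
    and Du: "Du \<in> carrier_mat n m" and Dy: "Dy \<in> carrier_mat n p"
    and acc: "acceptor (observer Ao Bu By Du Dy) (plant A B C D E F)" and schur: "schur_stable Ao"
  shows "unknown_input_observer (observer Ao Bu By Du Dy) (plant A B C D E F)"
  unfolding unknown_input_observer_def
proof (intro conjI allI impI)
  fix x u y d xh z
  assume sys: "(x, u, y, d) \<in> plant A B C D E F" and obs: "(xh, u, y, z) \<in> observer Ao Bu By Du Dy"
  obtain w where w: "(x, u, y, w) \<in> observer Ao Bu By Du Dy"
    using acc sys unfolding acceptor_def by blast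
  have car: "x t \<in> carrier_vec n" "xh t \<in> carrier_vec n" "u t \<in> carrier_vec m" "y t \<in> carrier_vec p"
    "z t \<in> carrier_vec n" "w t \<in> carrier_vec n" for t
    using w obs Ao Bu By by (auto simp: observer_def)
  have err: "x t - xh t = w t - z t" for t
  proof -
    have "x t = w t + Du *\<^sub>v u t + Dy *\<^sub>v y t" "xh t = z t + Du *\<^sub>v u t + Dy *\<^sub>v y t"
      using w obs by (auto simp: observer_def)
    then show ?thesis using car[of t] Du Dy by (intro eq_vecI) auto
  qed
  have "w (t + 1) - z (t + 1) = Ao *\<^sub>v (w t - z t)" for t
  proof -
    have "w (t + 1) = Ao *\<^sub>v w t + Bu *\<^sub>v u t + By *\<^sub>v y t"
      "z (t + 1) = Ao *\<^sub>v z t + Bu *\<^sub>v u t + By *\<^sub>v y t"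
      using w obs by (auto simp: observer_def)
    then show ?thesis using car[of t] Ao Bu By
      unfolding mult_minus_distrib_mat_vec[OF Ao car(6) car(5)]
      by (intro eq_vecI) (auto simp del: index_mult_mat_vec)
  qed
  then show "(\<lambda>t. euclid_norm (x t - xh t)) \<longlonglongrightarrow> 0"
    unfolding err using car
    by (intro tendsto_euclid_norm_0[of _ n] schur_stable_imp_tendsto_0[OF Ao schur]) auto
qed (rule acc)

section \<open>Acceptors as block rows that annihilate all windows\<close>

lemma six_block_mult_vec:
  fixes K1 :: "real mat"
  assumes "K1 \<in> carrier_mat k n" "K2 \<in> carrier_mat k n" "K3 \<in> carrier_mat k m" "K4 \<in> carrier_mat k m"
    "K5 \<in> carrier_mat k p" "K6 \<in> carrier_mat k p"
    and "x0 \<in> carrier_vec n" "x1 \<in> carrier_vec n" "u0 \<in> carrier_vec m" "u1 \<in> carrier_vec m"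
    "y0 \<in> carrier_vec p" "y1 \<in> carrier_vec p"
  shows "(K1 @\<^sub>c K2 @\<^sub>c K3 @\<^sub>c K4 @\<^sub>c K5 @\<^sub>c K6) *\<^sub>v (x0 @\<^sub>v x1 @\<^sub>v u0 @\<^sub>v u1 @\<^sub>v y0 @\<^sub>v y1)
    = K1 *\<^sub>v x0 + (K2 *\<^sub>v x1 + (K3 *\<^sub>v u0 + (K4 *\<^sub>v u1 + (K5 *\<^sub>v y0 + K6 *\<^sub>v y1))))"
  using assms by (simp add: append_cols_mult_append_vec)

text \<open>Eliminating the internal state from the observer equations, with the estimate equal to
  \<open>x\<close>, leaves one linear relation between the samples at times 0 and 1. The blocks are
  its coefficients.\<close>

lemma acceptor_imp_windows_subset:
  assumes Ao: "Ao \<in> carrier_mat n n" and Bu: "Bu \<in> carrier_mat n m" and By: "By \<in> carrier_mat n p"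
    and Du: "Du \<in> carrier_mat n m" and Dy: "Dy \<in> carrier_mat n p"
    and acc: "acceptor (observer Ao Bu By Du Dy) (plant A B C D E F)"
  shows "windows \<subseteq> mat_kernel
    (- Ao @\<^sub>c 1\<^sub>m n @\<^sub>c (Ao * Du - Bu) @\<^sub>c (- Du) @\<^sub>c (Ao * Dy - By) @\<^sub>c (- Dy))"
proof
  fix v assume "v \<in> windows"
  then obtain x0 x1 u0 u1 y0 y1 d0 d1
    where v: "v = x0 @\<^sub>v x1 @\<^sub>v u0 @\<^sub>v u1 @\<^sub>v y0 @\<^sub>v y1"
      and c: "d0 \<in> carrier_vec r" "d1 \<in> carrier_vec r" "x0 \<in> carrier_vec n"
        "u0 \<in> carrier_vec m" "u1 \<in> carrier_vec m"
      and eqs: "x1 = A *\<^sub>v x0 + B *\<^sub>v u0 + E *\<^sub>v d0" "y0 = C *\<^sub>v x0 + D *\<^sub>v u0 + F *\<^sub>v d0"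
        "y1 = C *\<^sub>v x1 + D *\<^sub>v u1 + F *\<^sub>v d1"
    unfolding windows_def by blast
  \<comment> \<open>The window only prescribes times 0 and 1; the later values are arbitrary and are
    kept constant.\<close>
  define u where "u t = (if t = 0 then u0 else u1)" for t :: nat
  define d where "d t = (if t = 0 then d0 else d1)" for t :: nat
  have ud: "u t \<in> carrier_vec m" "d t \<in> carrier_vec r" for t
    using c by (auto simp: u_def d_def)
  obtain x y where sys: "(x, u, y, d) \<in> plant A B C D E F" and x0: "x 0 = x0"
    by (rule plant_trajectory_exists[OF c(3) ud])
  have step: "x (Suc t) = A *\<^sub>v x t + B *\<^sub>v u t + E *\<^sub>v d t" "y t = C *\<^sub>v x t + D *\<^sub>v u t + F *\<^sub>v d t" for t
    using sys by (auto simp: plant_def)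
  have x1: "x 1 = x1" and y0: "y 0 = y0" using step[of 0] by (auto simp: eqs x0 u_def d_def)
  have y1: "y 1 = y1" using step(2)[of 1] unfolding x1 by (simp add: eqs(3) u_def d_def)
  obtain z where obs: "(x, u, y, z) \<in> observer Ao Bu By Du Dy"
    using acc sys unfolding acceptor_def by blast
  have car: "x t \<in> carrier_vec n" "u t \<in> carrier_vec m" "y t \<in> carrier_vec p" "z t \<in> carrier_vec n" for t
    using obs Ao Bu By by (auto simp: observer_def)
  have xt: "x t = z t + Du *\<^sub>v u t + Dy *\<^sub>v y t" for t using obs by (auto simp: observer_def)
  have "z (t + 1) = Ao *\<^sub>v z t + Bu *\<^sub>v u t + By *\<^sub>v y t" for t
    using obs by (auto simp: observer_def)
  from this[of 0] have zt: "z 1 = Ao *\<^sub>v z 0 + Bu *\<^sub>v u 0 + By *\<^sub>v y 0" by simp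
  have v': "v = x 0 @\<^sub>v x 1 @\<^sub>v u 0 @\<^sub>v u 1 @\<^sub>v y 0 @\<^sub>v y 1"
    unfolding v x0 x1 y0 y1 by (simp add: u_def)
  have 1: "Ao *\<^sub>v x 0 = Ao *\<^sub>v z 0 + Ao *\<^sub>v (Du *\<^sub>v u 0) + Ao *\<^sub>v (Dy *\<^sub>v y 0)"
    using Ao Du Dy car by (simp add: xt[of 0] mult_add_distrib_mat_vec[OF Ao])
  have 2: "x 1 = Ao *\<^sub>v z 0 + Bu *\<^sub>v u 0 + By *\<^sub>v y 0 + Du *\<^sub>v u 1 + Dy *\<^sub>v y 1"
    using xt[of 1] unfolding zt .
  have 3: "(Ao * Du - Bu) *\<^sub>v u 0 = Ao *\<^sub>v (Du *\<^sub>v u 0) - Bu *\<^sub>v u 0"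
    "(Ao * Dy - By) *\<^sub>v y 0 = Ao *\<^sub>v (Dy *\<^sub>v y 0) - By *\<^sub>v y 0"
    using Ao Bu By Du Dy car[of 0]
    by (simp_all add: minus_mult_distrib_mat_vec[of _ n m] minus_mult_distrib_mat_vec[of _ n p])
  let ?M = "- Ao @\<^sub>c 1\<^sub>m n @\<^sub>c (Ao * Du - Bu) @\<^sub>c (- Du) @\<^sub>c (Ao * Dy - By) @\<^sub>c (- Dy)"
  have M: "- Ao \<in> carrier_mat n n" "Ao * Du - Bu \<in> carrier_mat n m" "- Du \<in> carrier_mat n m"
    "Ao * Dy - By \<in> carrier_mat n p" "- Dy \<in> carrier_mat n p"
    using Ao Bu By Du Dy by (auto intro: minus_carrier_mat)
  have "?M *\<^sub>v v = - Ao *\<^sub>v x 0 + (1\<^sub>m n *\<^sub>v x 1 + ((Ao * Du - Bu) *\<^sub>v u 0 + (- Du *\<^sub>v u 1 +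
      ((Ao * Dy - By) *\<^sub>v y 0 + - Dy *\<^sub>v y 1))))"
    unfolding v'
    by (rule six_block_mult_vec[OF M(1) one_carrier_mat M(2-5) car(1) car(1) car(2) car(2) car(3) car(3)])
  also have "\<dots> = - (Ao *\<^sub>v x 0) + (x 1 + ((Ao * Du - Bu) *\<^sub>v u 0 + (- (Du *\<^sub>v u 1) +
      ((Ao * Dy - By) *\<^sub>v y 0 + - (Dy *\<^sub>v y 1)))))"
    using Ao Du Dy car[of 0] car[of 1] by simp
  \<comment> \<open>After \<open>x 0\<close> and \<open>x 1\<close> are expressed by
    \<open>z 0\<close>, inputs and outputs, all terms cancel. Matrix-vector products are kept folded
    so that they act as atoms.\<close>
  also have "\<dots> = 0\<^sub>v n"
    unfolding 1 2 3 using Ao Bu By Du Dy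
    by (intro eq_vecI) (simp_all del: index_mult_mat_vec)
  finally have Mv: "?M *\<^sub>v v = 0\<^sub>v n" .
  have "v \<in> carrier_vec (dim_col ?M)"
    unfolding v' by (intro carrier_vecI) (use Ao Bu By Du Dy car[of 0] car[of 1] in simp)
  with Mv Ao show "v \<in> mat_kernel ?M" by (simp add: mat_kernel_def)
qed

text \<open>The observer matrices result from solving for them in the block row of
  \<open>acceptor_imp_windows_subset\<close>: \<open>Wf = - Du\<close> gives \<open>Du\<close>, and
  then \<open>Wp = Ao * Du - Bu\<close> gives \<open>Bu\<close>. The output blocks are treated in
  the same way.\<close>

lemma windows_subset_imp_acceptor:
  assumes Ao: "Ao \<in> carrier_mat n n" and Wp: "Wp \<in> carrier_mat n m" and Wf: "Wf \<in> carrier_mat n m"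
    and Rp: "Rp \<in> carrier_mat n p" and Rf: "Rf \<in> carrier_mat n p"
    and sub: "windows \<subseteq> mat_kernel (- Ao @\<^sub>c 1\<^sub>m n @\<^sub>c Wp @\<^sub>c Wf @\<^sub>c Rp @\<^sub>c Rf)"
  shows "acceptor (observer Ao (- Wp - Ao * Wf) (- Rp - Ao * Rf) (- Wf) (- Rf)) (plant A B C D E F)"
  unfolding acceptor_def
proof (intro allI impI)
  fix x u y d assume sys: "(x, u, y, d) \<in> plant A B C D E F"
  have car: "x t \<in> carrier_vec n" "u t \<in> carrier_vec m" "y t \<in> carrier_vec p" "d t \<in> carrier_vec r" for t
    using sys A B C E by (auto simp: plant_def)
  \<comment> \<open>Absorbing the terms at time \<open>t + 1\<close> into the state makes the observer causal.\<close>
  define z where "z t = x t + Wf *\<^sub>v u t + Rf *\<^sub>v y t" for t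
  have z: "z t \<in> carrier_vec n" for t
    using car[of t] Wf Rf by (auto simp: z_def intro!: add_carrier_vec mult_mat_vec_carrier)
  have kern: "- (Ao *\<^sub>v x t) + (x (t + 1) + (Wp *\<^sub>v u t + (Wf *\<^sub>v u (t + 1) + (Rp *\<^sub>v y t + Rf *\<^sub>v y (t + 1))))) = 0\<^sub>v n"
    for t
  proof -
    have "x t @\<^sub>v x (t + 1) @\<^sub>v u t @\<^sub>v u (t + 1) @\<^sub>v y t @\<^sub>v y (t + 1) \<in> windows"
      using sys car unfolding windows_def plant_def by blast
    then show ?thesis
      using sub Ao Wp Wf Rp Rf car
        six_block_mult_vec[of "- Ao" n "1\<^sub>m n" Wp Wf Rp Rf
          "x t" "x (t + 1)" "u t" "u (t + 1)" "y t" "y (t + 1)"]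
      by (auto simp: mat_kernel_def)
  qed
  have "z (t + 1) = Ao *\<^sub>v z t + (- Wp - Ao * Wf) *\<^sub>v u t + (- Rp - Ao * Rf) *\<^sub>v y t" for t
  proof -
    have 1: "Ao *\<^sub>v z t = Ao *\<^sub>v x t + Ao *\<^sub>v (Wf *\<^sub>v u t) + Ao *\<^sub>v (Rf *\<^sub>v y t)"
      unfolding z_def using Ao Wf Rf car[of t]
      by (subst mult_add_distrib_mat_vec[OF Ao], auto)+
    have 2: "(- Wp - Ao * Wf) *\<^sub>v u t = - (Wp *\<^sub>v u t) - Ao *\<^sub>v (Wf *\<^sub>v u t)"
      "(- Rp - Ao * Rf) *\<^sub>v y t = - (Rp *\<^sub>v y t) - Ao *\<^sub>v (Rf *\<^sub>v y t)"
      using Ao Wp Wf Rp Rf car[of t]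
      by (simp_all add: minus_mult_distrib_mat_vec[of _ n m] minus_mult_distrib_mat_vec[of _ n p])
    have "(- (Ao *\<^sub>v x t) + (x (t + 1) + (Wp *\<^sub>v u t + (Wf *\<^sub>v u (t + 1) + (Rp *\<^sub>v y t + Rf *\<^sub>v y (t + 1)))))) $ i = 0"
      if "i < n" for i
      using that by (simp only: kern index_zero_vec)
    then show ?thesis
      unfolding 1 2 using Ao Wp Wf Rp Rf car[of t] car[of "t + 1"]
      by (auto simp: vec_eq_iff z_def algebra_simps simp del: index_mult_mat_vec)
  qed
  moreover have "x t = z t + (- Wf) *\<^sub>v u t + (- Rf) *\<^sub>v y t" for t
    using Wf Rf car[of t] by (auto simp: z_def vec_eq_iff)
  ultimately have "(x, u, y, z) \<in> observer Ao (- Wp - Ao * Wf) (- Rp - Ao * Rf) (- Wf) (- Rf)"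
    using Ao Wp Wf Rp Rf car z by (simp add: observer_def)
  then show "\<exists>z. (x, u, y, z) \<in> observer Ao (- Wp - Ao * Wf) (- Rp - Ao * Rf) (- Wf) (- Rf)" by blast
qed

end

section \<open>Existence of an observer and factorization through annihilators of the data\<close>

theorem theorem12:
  fixes A B C D E F :: "real mat"
    and n m p r T :: nat
    and x\<^sub>d u\<^sub>d y\<^sub>d d\<^sub>d :: "nat \<Rightarrow> real vec"
  assumes "A \<in> carrier_mat n n" "B \<in> carrier_mat n m" "C \<in> carrier_mat p n"
    and "D \<in> carrier_mat p m" "E \<in> carrier_mat n r" "F \<in> carrier_mat p r"
    and "vec_space.rank (n + p) (E @\<^sub>r F) = r"
    and "1 \<le> T"
    and "data_generated_by A B C D E F T x\<^sub>d u\<^sub>d y\<^sub>d d\<^sub>d"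
    and "vec_space.rank (n + m + m + r + r)
           (past n T x\<^sub>d @\<^sub>r past m T u\<^sub>d @\<^sub>r future m T u\<^sub>d @\<^sub>r past r T d\<^sub>d @\<^sub>r future r T d\<^sub>d)
         = n + m + m + r + r"
  shows
    "(\<exists>A\<^sub>o \<in> carrier_mat n n. \<exists>Bu \<in> carrier_mat n m. \<exists>By \<in> carrier_mat n p.
      \<exists>Du \<in> carrier_mat n m. \<exists>Dy \<in> carrier_mat n p.
        unknown_input_observer (observer A\<^sub>o Bu By Du Dy) (plant A B C D E F))
     \<longleftrightarrow>
     (\<forall>q. \<forall>Vp \<in> carrier_mat q n. \<forall>Vf \<in> carrier_mat q n.
          \<forall>Wp \<in> carrier_mat q m. \<forall>Wf \<in> carrier_mat q m.
          \<forall>Rp \<in> carrier_mat q p. \<forall>Rf \<in> carrier_mat q p.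
        mat_kernel (Vp @\<^sub>c Vf @\<^sub>c Wp @\<^sub>c Wf @\<^sub>c Rp @\<^sub>c Rf)
          = vec_space.col_space (2 * (n + m + p)) (data_matrix n m p T x\<^sub>d u\<^sub>d y\<^sub>d)
        \<longrightarrow> (\<exists>\<Omega> \<in> carrier_mat n q. \<exists>A\<^sub>s \<in> carrier_mat n n.
              schur_stable A\<^sub>s \<and> \<Omega> * (Vp @\<^sub>c Vf) = (- A\<^sub>s) @\<^sub>c 1\<^sub>m n))"
proof -
  interpret plant_matrices A B C D E F n m p r
    by unfold_locales (fact assms)+
  let ?\<Phi> = "data_matrix n m p T x\<^sub>d u\<^sub>d y\<^sub>d"
  have \<Phi>: "?\<Phi> \<in> carrier_mat (2 * (n + m + p)) (T - 1)"
    by (auto simp: data_matrix_def intro: carrier_matI)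
  have image: "vec_space.col_space (2 * (n + m + p)) ?\<Phi> = windows"
    by (rule col_space_data_matrix) (fact assms)+
  show ?thesis
  proof (intro iffI allI ballI impI)
    fix q Vp Vf Wp Wf Rp Rf
    assume V: "Vp \<in> carrier_mat q n" "Vf \<in> carrier_mat q n" "Wp \<in> carrier_mat q m"
        "Wf \<in> carrier_mat q m" "Rp \<in> carrier_mat q p" "Rf \<in> carrier_mat q p"
      and ker: "mat_kernel (Vp @\<^sub>c Vf @\<^sub>c Wp @\<^sub>c Wf @\<^sub>c Rp @\<^sub>c Rf)
          = vec_space.col_space (2 * (n + m + p)) ?\<Phi>"
    assume "\<exists>A\<^sub>o \<in> carrier_mat n n. \<exists>Bu \<in> carrier_mat n m. \<exists>By \<in> carrier_mat n p.
      \<exists>Du \<in> carrier_mat n m. \<exists>Dy \<in> carrier_mat n p.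
        unknown_input_observer (observer A\<^sub>o Bu By Du Dy) (plant A B C D E F)"
    then obtain Ao Bu By Du Dy
      where o: "Ao \<in> carrier_mat n n" "Bu \<in> carrier_mat n m" "By \<in> carrier_mat n p"
          "Du \<in> carrier_mat n m" "Dy \<in> carrier_mat n p"
        and uio: "unknown_input_observer (observer Ao Bu By Du Dy) (plant A B C D E F)"
      by blast
    have M: "Ao * Du - Bu \<in> carrier_mat n m" "- Du \<in> carrier_mat n m"
      "Ao * Dy - By \<in> carrier_mat n p" "- Dy \<in> carrier_mat n p" "- Ao \<in> carrier_mat n n"
      using o by (auto intro: minus_carrier_mat)
    \<comment> \<open>Only the first two block columns are compared in the end, so the other four
      are grouped.\<close>
    define V2 where "V2 = Wp @\<^sub>c Wf @\<^sub>c Rp @\<^sub>c Rf"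
    define M2 where "M2 = (Ao * Du - Bu) @\<^sub>c (- Du) @\<^sub>c (Ao * Dy - By) @\<^sub>c (- Dy)"
    have V2: "V2 \<in> carrier_mat q (m + (m + (p + p)))"
      unfolding V2_def by (intro append_cols_carrier V)
    have M2: "M2 \<in> carrier_mat n (m + (m + (p + p)))"
      unfolding M2_def by (intro append_cols_carrier M)
    have VV: "Vf @\<^sub>c V2 \<in> carrier_mat q (n + (m + (m + (p + p))))"
      and MM: "1\<^sub>m n @\<^sub>c M2 \<in> carrier_mat n (n + (m + (m + (p + p))))"
      by (intro append_cols_carrier V V2 M2 one_carrier_mat)+
    \<comment> \<open>The left kernel is the set of windows, and the block row of an acceptor
      annihilates every window.\<close>
    have "mat_kernel (Vp @\<^sub>c Vf @\<^sub>c V2) \<subseteq> mat_kernel (- Ao @\<^sub>c 1\<^sub>m n @\<^sub>c M2)"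
      using acceptor_imp_windows_subset[OF o] uio
      unfolding V2_def M2_def ker image unknown_input_observer_def by blast
    then obtain \<Omega> where \<Omega>: "\<Omega> \<in> carrier_mat n q"
      and eq: "\<Omega> * (Vp @\<^sub>c Vf @\<^sub>c V2) = - Ao @\<^sub>c 1\<^sub>m n @\<^sub>c M2"
      using mat_kernel_factor[OF append_cols_carrier[OF V(1) VV] append_cols_carrier[OF M(5) MM]]
      by blast
    have \<Omega>V: "\<Omega> * Vp \<in> carrier_mat n n" "\<Omega> * Vf \<in> carrier_mat n n"
      "\<Omega> * V2 \<in> carrier_mat n (m + (m + (p + p)))"
      using \<Omega> V V2 by auto
    have "\<Omega> * Vp @\<^sub>c \<Omega> * Vf @\<^sub>c \<Omega> * V2 = - Ao @\<^sub>c 1\<^sub>m n @\<^sub>c M2"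
      using eq by (simp only: mult_append_cols[OF \<Omega> V(1) VV] mult_append_cols[OF \<Omega> V(2) V2])
    hence "\<Omega> * Vp = - Ao" "\<Omega> * Vf = 1\<^sub>m n"
      using append_cols_eq_iff[OF \<Omega>V(1) M(5) append_cols_carrier[OF \<Omega>V(2,3)] MM]
        append_cols_eq_iff[OF \<Omega>V(2) one_carrier_mat \<Omega>V(3) M2] by simp_all
    hence "\<Omega> * (Vp @\<^sub>c Vf) = - Ao @\<^sub>c 1\<^sub>m n"
      using mult_append_cols[OF \<Omega> V(1) V(2)] by simp
    \<comment> \<open>The Schur matrix sought is the observer's own state matrix.\<close>
    then show "\<exists>\<Omega> \<in> carrier_mat n q. \<exists>A\<^sub>s \<in> carrier_mat n n.
        schur_stable A\<^sub>s \<and> \<Omega> * (Vp @\<^sub>c Vf) = (- A\<^sub>s) @\<^sub>c 1\<^sub>m n"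
      using \<Omega> o(1) unknown_input_observer_imp_schur_stable[OF o uio] by blast
  next
    assume *: "\<forall>q. \<forall>Vp \<in> carrier_mat q n. \<forall>Vf \<in> carrier_mat q n.
          \<forall>Wp \<in> carrier_mat q m. \<forall>Wf \<in> carrier_mat q m.
          \<forall>Rp \<in> carrier_mat q p. \<forall>Rf \<in> carrier_mat q p.
        mat_kernel (Vp @\<^sub>c Vf @\<^sub>c Wp @\<^sub>c Wf @\<^sub>c Rp @\<^sub>c Rf)
          = vec_space.col_space (2 * (n + m + p)) ?\<Phi>
        \<longrightarrow> (\<exists>\<Omega> \<in> carrier_mat n q. \<exists>A\<^sub>s \<in> carrier_mat n n.
              schur_stable A\<^sub>s \<and> \<Omega> * (Vp @\<^sub>c Vf) = (- A\<^sub>s) @\<^sub>c 1\<^sub>m n)"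
    define q where "q = 2 * (n + m + p)"
    obtain V where V: "V \<in> carrier_mat q q" and ker: "mat_kernel V = windows"
      using col_space_is_mat_kernel[OF \<Phi>] image by (auto simp: q_def)
    \<comment> \<open>The sum is nested to the right, as \<open>append_cols\<close> associates, so
      that the blocks can be split off one at a time.\<close>
    have "q = n + (n + (m + (m + (p + p))))" by (simp add: q_def)
    with V have V0: "V \<in> carrier_mat q (n + (n + (m + (m + (p + p)))))" by (simp only:)
    obtain Vp V1 where c1: "Vp \<in> carrier_mat q n" "V1 \<in> carrier_mat q (n + (m + (m + (p + p))))"
      and e1: "V = Vp @\<^sub>c V1" by (rule append_cols_cases[OF V0])
    obtain Vf V2 where c2: "Vf \<in> carrier_mat q n" "V2 \<in> carrier_mat q (m + (m + (p + p)))"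
      and e2: "V1 = Vf @\<^sub>c V2" by (rule append_cols_cases[OF c1(2)])
    obtain Wp V3 where c3: "Wp \<in> carrier_mat q m" "V3 \<in> carrier_mat q (m + (p + p))"
      and e3: "V2 = Wp @\<^sub>c V3" by (rule append_cols_cases[OF c2(2)])
    obtain Wf V4 where c4: "Wf \<in> carrier_mat q m" "V4 \<in> carrier_mat q (p + p)"
      and e4: "V3 = Wf @\<^sub>c V4" by (rule append_cols_cases[OF c3(2)])
    obtain Rp Rf where c5: "Rp \<in> carrier_mat q p" "Rf \<in> carrier_mat q p"
      and e5: "V4 = Rp @\<^sub>c Rf" by (rule append_cols_cases[OF c4(2)])
    note c = c1(1) c2(1) c3(1) c4(1) c5
    have "mat_kernel (Vp @\<^sub>c Vf @\<^sub>c Wp @\<^sub>c Wf @\<^sub>c Rp @\<^sub>c Rf)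
        = vec_space.col_space (2 * (n + m + p)) ?\<Phi>"
      unfolding image ker[symmetric] e1 e2 e3 e4 e5 ..
    then obtain \<Omega> As where \<Omega>: "\<Omega> \<in> carrier_mat n q" and As: "As \<in> carrier_mat n n" "schur_stable As"
      and eq: "\<Omega> * (Vp @\<^sub>c Vf) = (- As) @\<^sub>c 1\<^sub>m n"
      using *[rule_format, OF c] by blast
    have P: "\<Omega> * Wp \<in> carrier_mat n m" "\<Omega> * Wf \<in> carrier_mat n m"
        "\<Omega> * Rp \<in> carrier_mat n p" "\<Omega> * Rf \<in> carrier_mat n p"
      using \<Omega> c by auto
    have "\<Omega> * Vp @\<^sub>c \<Omega> * Vf = - As @\<^sub>c 1\<^sub>m n"
      using eq by (simp only: mult_append_cols[OF \<Omega> c(1,2)])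
    moreover have "\<Omega> * Vp \<in> carrier_mat n n" "\<Omega> * Vf \<in> carrier_mat n n" "- As \<in> carrier_mat n n"
      using \<Omega> c As by auto
    ultimately have "\<Omega> * Vp = - As" "\<Omega> * Vf = 1\<^sub>m n"
      using append_cols_eq_iff[of "\<Omega> * Vp" n n "- As" "\<Omega> * Vf" n "1\<^sub>m n"] by simp_all
    \<comment> \<open>The first two blocks are fixed by the hypothesis; the remaining four,
      multiplied by \<open>\<Omega>\<close>, become the coefficients from which the observer is
      built.\<close>
    hence \<Omega>V: "\<Omega> * V = - As @\<^sub>c 1\<^sub>m n @\<^sub>c \<Omega> * Wp @\<^sub>c \<Omega> * Wf @\<^sub>c \<Omega> * Rp @\<^sub>c \<Omega> * Rf"
      unfolding e1 mult_append_cols[OF \<Omega> c1]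
      unfolding e2 mult_append_cols[OF \<Omega> c2]
      unfolding e3 mult_append_cols[OF \<Omega> c3]
      unfolding e4 mult_append_cols[OF \<Omega> c4]
      unfolding e5 mult_append_cols[OF \<Omega> c5] by simp
    \<comment> \<open>Multiplication from the left can only enlarge the kernel, so the product still
      annihilates all windows.\<close>
    have "mat_kernel V \<subseteq> mat_kernel (\<Omega> * V)"
      using \<Omega> V by (auto simp: mat_kernel_def)
    hence "windows \<subseteq> mat_kernel (- As @\<^sub>c 1\<^sub>m n @\<^sub>c \<Omega> * Wp @\<^sub>c \<Omega> * Wf @\<^sub>c \<Omega> * Rp @\<^sub>c \<Omega> * Rf)"
      by (simp add: ker \<Omega>V)
    note acc = windows_subset_imp_acceptor[OF As(1) P this]
    have K: "- (\<Omega> * Wp) - As * (\<Omega> * Wf) \<in> carrier_mat n m" "- (\<Omega> * Rp) - As * (\<Omega> * Rf) \<in> carrier_mat n p"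
      "- (\<Omega> * Wf) \<in> carrier_mat n m" "- (\<Omega> * Rf) \<in> carrier_mat n p"
      using P As by (auto intro: minus_carrier_mat)
    show "\<exists>A\<^sub>o \<in> carrier_mat n n. \<exists>Bu \<in> carrier_mat n m. \<exists>By \<in> carrier_mat n p.
      \<exists>Du \<in> carrier_mat n m. \<exists>Dy \<in> carrier_mat n p.
        unknown_input_observer (observer A\<^sub>o Bu By Du Dy) (plant A B C D E F)"
      using acceptor_schur_stable_imp_unknown_input_observer[OF As(1) K acc As(2)] As(1) K by blast
  qed
qed

end
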